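(* Let $n \ge 2$ be an integer and let $x_1, x_2, \dots, x_n$ be positive real numbers. Then $$\sum_{i=1}^{n} \frac{x_i}{\left(\sum_{j=1}^{n} x_j\right) - x_i} \ge \frac{n}{n-1},$$ and equality holds if and only if $x_1 = x_2 = \cdots = x_n$. *)

theory Defs
  imports Complex_Main
begin

end

theory Submission
  imports Defs
begin

text \<open>Let \<open>S\<close> be the sum of the \<open>x\<^sub>i\<close>, \<open>d\<^sub>i = S - x\<^sub>i\<close>, and let \<open>c = (n - 1) S / n\<close> be the mean of the
  \<open>d\<^sub>i\<close>. Expanding \<open>1 / d\<^sub>i\<close> about \<open>c\<close> with exact remainder and summing, the linear terms cancel and
  the difference of the two sides of the inequality is \<open>\<Sum> S (d\<^sub>i - c)\<^sup>2 / (c\<^sup>2 d\<^sub>i)\<close>.\<close>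

text \<open>The terms \<open>2 / c - d / c^2\<close> are the tangent line of \<open>1 / d\<close> at
  \<open>c\<close>; after multiplication by \<open>c^2 * d\<close> the claim is
  \<open>c^2 = 2*c*d - d^2 + (d - c)^2\<close>.\<close>

lemma inverse_tangent_remainder:
  fixes c d :: real
  assumes "c \<noteq> 0" "d \<noteq> 0"
  shows "1 / d = 2 / c - d / c^2 + (d - c)^2 / (c^2 * d)"
  using assms by (simp add: divide_simps) (simp add: algebra_simps power2_eq_square)

theorem theorem2p2:
  fixes n :: nat and x :: "nat \<Rightarrow> real"
  assumes "n \<ge> 2" and "\<And>i. i \<in> {1..n} \<Longrightarrow> x i > 0"
  shows "(\<Sum>i=1..n. x i / ((\<Sum>j=1..n. x j) - x i)) \<ge> real n / (real n - 1)
    \<and> ((\<Sum>i=1..n. x i / ((\<Sum>j=1..n. x j) - x i)) = real n / (real n - 1)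
         \<longleftrightarrow> (\<forall>i\<in>{1..n}. \<forall>j\<in>{1..n}. x i = x j))"
proof -
  define S where "S = (\<Sum>j=1..n. x j)"
  define c where "c = S * (real n - 1) / real n"
  define r where "r i = S * ((S - x i - c)^2 / (c^2 * (S - x i)))" for i
  have n: "real n > 1" using assms(1) by simp
  have S: "S > 0"
    unfolding S_def using assms by (intro sum_pos) auto
  have c: "c > 0" using S n by (simp add: c_def)
  have d: "S - x i > 0" if "i \<in> {1..n}" for i
  proof -
    have "S - x i = (\<Sum>j\<in>{1..n} - {i}. x j)"
      using that by (simp add: S_def sum_diff1)
    \<comment> \<open>An index other than \<open>i\<close>, available since
      \<open>n \<ge> 2\<close>, makes the sum nonempty and hence strictly positive.\<close>
    moreover have "(if i = 1 then 2 else 1) \<in> {1..n} - {i}"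
      using assms(1) by simp
    then have "{1..n} - {i} \<noteq> {}" by blast
    ultimately show ?thesis using assms(2) by (auto intro!: sum_pos)
  qed
  have term_eq: "x i / (S - x i) = (2 * S / c - 1) - S / c^2 * (S - x i) + r i" if "i \<in> {1..n}" for i
  proof -
    \<comment> \<open>Writing \<open>x i = S - (S - x i)\<close> leaves only the reciprocal to
      expand.\<close>
    have "x i / (S - x i) = S * (1 / (S - x i)) - 1"
      using d[OF that] by (simp add: field_simps)
    then show ?thesis
      using inverse_tangent_remainder[of c "S - x i"] c d[OF that]
      by (simp add: r_def algebra_simps)
  qed
  have sum_d: "(\<Sum>i=1..n. S - x i) = real n * c"
    using n unfolding sum_subtractf S_def[symmetric] by (simp add: c_def field_simps)
  have "(\<Sum>i=1..n. x i / (S - x i))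
      = (\<Sum>i=1..n. (2 * S / c - 1) - S / c^2 * (S - x i)) + (\<Sum>i=1..n. r i)"
    unfolding sum.distrib[symmetric] by (intro sum.cong refl term_eq)
  also have "(\<Sum>i=1..n. (2 * S / c - 1) - S / c^2 * (S - x i))
      = (\<Sum>i=1..n. 2 * S / c - 1) - (\<Sum>i=1..n. S / c^2 * (S - x i))"
    by (rule sum_subtractf)
  also have "\<dots> = real n * (2 * S / c - 1) - S / c^2 * (\<Sum>i=1..n. S - x i)"
    unfolding sum_distrib_left by simp
  also have "\<dots> = real n * (S / c - 1)"
    using c unfolding sum_d by (simp add: field_simps power2_eq_square)
  \<comment> \<open>Here \<open>S / c = n / (n - 1)\<close>, so
    \<open>S / c - 1 = 1 / (n - 1)\<close>.\<close>
  also have "\<dots> = real n / (real n - 1)"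
    using S n by (simp add: c_def divide_simps)
  finally have sum_eq: "(\<Sum>i=1..n. x i / (S - x i)) = real n / (real n - 1) + (\<Sum>i=1..n. r i)" .
  have r_nonneg: "r i \<ge> 0" if "i \<in> {1..n}" for i
    unfolding r_def using S d[OF that] by (intro mult_nonneg_nonneg divide_nonneg_nonneg) auto
  have r_0: "r i = 0 \<longleftrightarrow> x i = S - c" if "i \<in> {1..n}" for i
    unfolding r_def using S c d[OF that] by auto
  have "(\<Sum>i=1..n. r i) = 0 \<longleftrightarrow> (\<forall>i\<in>{1..n}. r i = 0)"
    using r_nonneg by (intro sum_nonneg_eq_0_iff) auto
  also have "\<dots> \<longleftrightarrow> (\<forall>i\<in>{1..n}. x i = S - c)"
    by (intro ball_cong refl r_0)
  also have "\<dots> \<longleftrightarrow> (\<forall>i\<in>{1..n}. \<forall>j\<in>{1..n}. x i = x j)"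
  proof
    assume "\<forall>i\<in>{1..n}. x i = S - c"
    then show "\<forall>i\<in>{1..n}. \<forall>j\<in>{1..n}. x i = x j" by metis
  next
    assume eq: "\<forall>i\<in>{1..n}. \<forall>j\<in>{1..n}. x i = x j"
    show "\<forall>i\<in>{1..n}. x i = S - c"
    proof
      fix i assume i: "i \<in> {1..n}"
      have "S = (\<Sum>j=1..n. x i)"
        unfolding S_def by (intro sum.cong refl eq[rule_format] i)
      then have "S = real n * x i" by simp
      \<comment> \<open>By the choice of \<open>c\<close>, \<open>S - c = S / n\<close>, the mean of
        the \<open>x i\<close>.\<close>
      then show "x i = S - c"
        using n by (simp add: c_def field_simps)
    qed
  qed
  finally have "(\<Sum>i=1..n. r i) = 0 \<longleftrightarrow> (\<forall>i\<in>{1..n}. \<forall>j\<in>{1..n}. x i = x j)" .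
  moreover have "(\<Sum>i=1..n. r i) \<ge> 0"
    using r_nonneg by (intro sum_nonneg) auto
  ultimately show ?thesis
    unfolding S_def[symmetric] sum_eq by simp
qed

end
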